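(* Assume the standing setting with Assumptions (A1) and (A2). Let $\alpha\in(0,1)$, $\mu\in\mathfrak F$, $X\sim\mu$. Let $\sigma$ be a (random) permutation of $\{1,\dots,m\}$ with $p_{\sigma(1)}\le\dots\le p_{\sigma(m)}$, $p_{(k)}=p_{\sigma(k)}$, and $R_k=\{\sigma(1),\dots,\sigma(k)\}$. Each of the following three reference families $(R_k,\zeta_k)_{1\le k\le m}$ satisfies $\mathrm{JER}_\mu\le\alpha$: 1. $\zeta_k=\mathbf 1\{p_{(k)}>0\}\big\lfloor mp_{(k)}+\sqrt{\tfrac m2\log\tfrac1\alpha}\big\rfloor\wedge k$; 2. $\zeta_k=0$ if $p_{(k)}=0$ and otherwise $\zeta_k=\Big\lfloor mp_{(k)}\,h^{-1}\Big(\frac{2\log(\kappa/\alpha)+4\log(1+\log_2(1/p_{(k)}))}{mp_{(k)}}\Big)\Big\rfloor\wedge k$; 3. $\zeta_k=\mathbf 1\{p_{(k)}>0\}\big(\lceil mp_{(k)}/\alpha\rceil-1\big)\wedge k$.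
   Context: Standing setting: data $X$ with law $\mu$ in a model $\mathfrak F$; null hypotheses $H_1,\dots,H_m\subseteq\mathfrak F$; $\mathcal H_0(\mu)=\{i:\mu\in H_i\}$; $p$-values $p_i=p_i(X)\in[0,1]$. (A1): for $i\in\mathcal H_0(\mu)$, $\mathbb P_\mu(p_i\le x)\le 0\vee(x\wedge1)$ for all $x$. (A2): $(p_i)_{i\in\mathcal H_0(\mu)}$ mutually independent. A reference family is a finite family $(R_k,\zeta_k)_{k\in\mathcal K}$ of (data-dependent) subsets $R_k\subseteq\{1,\dots,m\}$ and integers $\zeta_k$; its joint error rate is $\mathrm{JER}_\mu=\mathbb P_\mu(\exists k\in\mathcal K:\ |R_k\cap\mathcal H_0(\mu)|>\zeta_k)$. $\kappa=\pi^2/6$, $h(x)=x(\log x-1)+1$ on $(1,\infty)$, $h^{-1}$ its inverse $(0,\infty)\to(1,\infty)$. *)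

theory Defs
  imports "HOL-Probability.Probability"
begin

definition kappa :: real where "kappa = pi^2 / 6"

definition hfun :: "real \<Rightarrow> real" where "hfun x = x * (ln x - 1) + 1"

text \<open>Inverse of h restricted to (1,infinity), as a map (0,infinity) to (1,infinity).\<close>
definition hinv :: "real \<Rightarrow> real" where "hinv y = (THE x. x > 1 \<and> hfun x = y)"

definition zeta_hoeffding :: "nat \<Rightarrow> real \<Rightarrow> nat \<Rightarrow> real \<Rightarrow> int" where
  "zeta_hoeffding m \<alpha> k pk =
     (if pk > 0 then 1 else 0) *
     min (\<lfloor>real m * pk + sqrt (real m / 2 * ln (1 / \<alpha>))\<rfloor>) (int k)"

definition zeta_bennett :: "nat \<Rightarrow> real \<Rightarrow> nat \<Rightarrow> real \<Rightarrow> int" where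
  "zeta_bennett m \<alpha> k pk =
     (if pk = 0 then 0 else
      min (\<lfloor>real m * pk * hinv ((2 * ln (kappa / \<alpha>) + 4 * ln (1 + log 2 (1 / pk)))
                                   / (real m * pk))\<rfloor>) (int k))"

definition zeta_simes :: "nat \<Rightarrow> real \<Rightarrow> nat \<Rightarrow> real \<Rightarrow> int" where
  "zeta_simes m \<alpha> k pk =
     (if pk > 0 then 1 else 0) * min (\<lceil>real m * pk / \<alpha>\<rceil> - 1) (int k)"

definition JER :: "'a measure \<Rightarrow> nat \<Rightarrow> nat set \<Rightarrow> ('a \<Rightarrow> nat \<Rightarrow> nat set)
                    \<Rightarrow> ('a \<Rightarrow> nat \<Rightarrow> int) \<Rightarrow> real" where
  "JER M m H0 R \<zeta> =
     measure M {x \<in> space M. \<exists>k\<in>{1..m}. int (card (R x k \<inter> H0)) > \<zeta> x k}"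

end

theory Submission
  imports Defs
begin

text \<open>
  Let \<open>N t\<close> be the number of true null p-values below \<open>t\<close>. All three families follow from one maximal
  inequality for \<open>(1 + c / t) ^ N t\<close>, which is a reverse martingale when the p-values are uniform:
  with \<open>n\<close> true nulls, it exceeds \<open>B > 1\<close> somewhere on \<open>(0, 1]\<close> with probability at most
  \<open>((1 + c) ^ n - 1) / (B - 1)\<close>. For superuniform p-values the reverse martingale property fails, but
  expanding the power over subsets \<open>S\<close> of the nulls and noting that, on the event that all of \<open>S\<close>
  is rejected at the last crossing time, this time is a function of the p-values outside \<open>S\<close> gives
  the same bound.

  The first family is the one-sided DKW inequality with Massart's constant: for every deviation \<open>e\<close>
  some \<open>c\<close> satisfies \<open>(t + e) ln (1 + c / t) - ln (1 + c) \<ge> 2 e\<^sup>2\<close> for all \<open>t \<le> 1 - e\<close>. It is the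
  optimal tilt at the point \<open>u\<close> minimising the Bernoulli divergence of \<open>u + e\<close> from \<open>u\<close>.
  The second family follows by peeling over dyadic slabs, the third by letting \<open>c\<close> tend to zero.
\<close>

section \<open>Elementary inequalities\<close>

lemma two_mult_le_ln_ratio:
  fixes y :: real
  assumes "0 \<le> y" "y < 1"
  shows "2 * y \<le> ln ((1 + y) / (1 - y))"
proof -
  let ?f = "\<lambda>y::real. ln (1 + y) - ln (1 - y) - 2 * y"
  have "?f 0 \<le> ?f y"
  proof (rule DERIV_nonneg_imp_nondecreasing[OF assms(1)])
    fix x :: real assume x: "0 \<le> x" "x \<le> y"
    have "(?f has_real_derivative (1 / (1 + x) + 1 / (1 - x) - 2)) (at x)"
      using x assms by (auto intro!: derivative_eq_intros)
    moreover have "1 / (1 + x) + 1 / (1 - x) - 2 = 2 * x\<^sup>2 / ((1 + x) * (1 - x))"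
      using x assms by (simp add: divide_simps) (simp add: algebra_simps power2_eq_square)
    moreover have "0 \<le> 2 * x\<^sup>2 / ((1 + x) * (1 - x))"
      using x assms by simp
    ultimately show "\<exists>D. (?f has_real_derivative D) (at x) \<and> 0 \<le> D"
      by metis
  qed
  then show ?thesis
    using assms by (simp add: ln_div)
qed

lemma ln_le_half_diff_inverse:
  fixes y :: real
  assumes "1 \<le> y"
  shows "ln y \<le> (y - 1 / y) / 2"
proof -
  let ?f = "\<lambda>y::real. (y - 1 / y) / 2 - ln y"
  have "?f 1 \<le> ?f y"
  proof (rule DERIV_nonneg_imp_nondecreasing[OF assms(1)])
    fix x :: real assume x: "1 \<le> x" "x \<le> y"
    have "(?f has_real_derivative ((1 - 1 / x)\<^sup>2 / 2)) (at x)"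
      using x by (auto intro!: derivative_eq_intros simp: field_simps power2_eq_square)
    then show "\<exists>D. (?f has_real_derivative D) (at x) \<and> 0 \<le> D"
      by (intro exI[of _ "(1 - 1 / x)\<^sup>2 / 2"]) auto
  qed
  then show ?thesis by simp
qed

section \<open>Bernoulli divergence and the tilt for the Hoeffding boundary\<close>

lemma four_mult_le_one:
  fixes x :: real
  shows "4 * (x * (1 - x)) \<le> 1"
  using zero_le_power2[of "2 * x - 1"] by (simp add: power2_eq_square algebra_simps)

text \<open>Pinsker's inequality for Bernoulli laws: the difference of the two sides is convex in
  \<open>s\<close>, because 1 / (x (1 - x)) \<ge> 4 on (0, 1), and has value and slope zero at
  \<open>s = 0\<close>.\<close>

lemma bernoulli_pinsker:
  fixes t s :: real
  assumes "0 < t" "0 \<le> s" "t + s < 1"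
  shows "2 * s\<^sup>2 \<le> (t + s) * ln ((t + s) / t) + (1 - t - s) * ln ((1 - t - s) / (1 - t))"
proof -
  let ?f = "\<lambda>s. (t + s) * (ln (t + s) - ln t) + (1 - t - s) * (ln (1 - t - s) - ln (1 - t)) - 2 * s\<^sup>2"
  let ?f' = "\<lambda>s. (ln (t + s) - ln t) - (ln (1 - t - s) - ln (1 - t)) - 4 * s"
  let ?f'' = "\<lambda>s. 1 / (t + s) + 1 / (1 - t - s) - 4"
  have "?f' 0 * (s - 0) \<le> ?f s - ?f 0"
  proof (rule f''_imp_f'[of "{- t<..<1 - t}" ?f ?f' ?f''])
    fix x assume x: "x \<in> {- t<..<1 - t}"
    then have pos: "0 < t + x" "0 < 1 - t - x" by auto
    show "(?f has_real_derivative ?f' x) (at x)"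
      using pos by (auto intro!: derivative_eq_intros)
    show "(?f' has_real_derivative ?f'' x) (at x)"
      using pos by (auto intro!: derivative_eq_intros)
    have "4 \<le> 1 / ((t + x) * (1 - (t + x)))"
      using four_mult_le_one[of "t + x"] pos by (subst pos_le_divide_eq) auto
    also have "\<dots> = 1 / (t + x) + 1 / (1 - t - x)"
      using pos by (simp add: divide_simps)
    finally show "0 \<le> ?f'' x" by simp
  qed (use assms in auto)
  then show ?thesis using assms by (simp add: ln_div)
qed

text \<open>The equation makes the Bernoulli divergence of \<open>t + e\<close> from
  \<open>t\<close> stationary in \<open>t\<close>; \<open>D\<close> is its derivative.
  \<open>D\<close> is nonpositive at (1 - e) / 2, where \<open>t\<close> and \<open>t + e\<close>
  are symmetric about 1/2, and nonnegative at 1/2 or, if 1/2 is not below \<open>1 - e\<close>,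
  close to \<open>1 - e\<close>.\<close>

lemma kl_stationary_point_exists:
  fixes e :: real
  assumes e: "0 < e" "e < 1"
  obtains t where "(1 - e) / 2 \<le> t" "t \<le> 1 / 2" "t < 1 - e"
    "ln ((t + e) * (1 - t) / (t * (1 - t - e))) = e / (t * (1 - t))"
proof -
  define D where "D = (\<lambda>t. ln ((t + e) * (1 - t) / (t * (1 - t - e))) - e / (t * (1 - t)))"
  define a where "a = (1 - e) / 2"
  have a: "0 < a" "a < 1 - e" "a < 1 / 2" using e by (auto simp: a_def)
  have Da: "D a \<le> 0"
  proof -
    define y where "y = (1 + e) / (1 - e)"
    have y: "1 \<le> y" using e by (simp add: y_def)
    have "(a + e) * (1 - a) / (a * (1 - a - e)) = y\<^sup>2"
      using e by (simp add: a_def y_def divide_simps power2_eq_square)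
    then have "D a = 2 * ln y - e / (a * (1 - a))"
      using y by (simp add: D_def ln_realpow)
    moreover have "e / (a * (1 - a)) = y - 1 / y"
    proof -
      have 1: "a * (1 - a) = (1 - e) * (1 + e) / 4" by (simp add: a_def field_simps)
      have 2: "y - 1 / y = 4 * e / ((1 - e) * (1 + e))"
        using e by (simp add: y_def divide_simps) (simp add: algebra_simps)
      show ?thesis unfolding 1 2 by simp
    qed
    ultimately show ?thesis using ln_le_half_diff_inverse[OF y] by simp
  qed
  obtain u where u: "a \<le> u" "u \<le> 1 / 2" "u < 1 - e" "0 \<le> D u"
  proof (cases "e < 1 / 2")
    case True
    have "D (1 / 2) = ln ((1 + 2 * e) / (1 - 2 * e)) - 4 * e"
      using True e by (simp add: D_def field_simps)
    then have "0 \<le> D (1 / 2)"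
      using two_mult_le_ln_ratio[of "2 * e"] True e by simp
    then show ?thesis using that[of "1/2"] True a by simp
  next
    case False
    \<comment> \<open>The logarithm in \<open>D\<close> blows up as \<open>u\<close> tends to
      \<open>1 - e\<close>. This \<open>r\<close> pushes it above \<open>1 / a\<close>, a bound for
      the subtracted fraction; \<open>r \<le> a\<close> keeps \<open>a \<le> u\<close> because
      \<open>1 - e\<close> is twice \<open>a\<close>.\<close>
    define r where "r = min a (e / 2 * exp (- (1 / a)))"
    have r: "0 < r" "r \<le> a" "r \<le> e / 2 * exp (- (1 / a))"
      using a e by (auto simp: r_def)
    define u where "u = 1 - e - r"
    have u: "a \<le> u" "u < 1 - e" "u \<le> 1 / 2" "0 < u"
      using r a False by (auto simp: u_def a_def)
    have 1: "e / (u * (1 - u)) \<le> 1 / a"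
    proof -
      have "a * e \<le> u * (1 - u)" using u a e by (intro mult_mono) auto
      then show ?thesis using u a e by (simp add: field_simps)
    qed
    have "exp (1 / a) * r \<le> e / 2"
      using mult_left_mono[OF r(3), of "exp (1 / a)"] by (simp add: exp_minus field_simps)
    then have "exp (1 / a) \<le> (1 / 2) * e / r"
      using r by (simp add: field_simps)
    also have "\<dots> \<le> (u + e) * (1 - u) / r"
      using r u a e False by (intro divide_right_mono mult_mono) auto
    also have "\<dots> \<le> (u + e) * (1 - u) / (u * (1 - u - e))"
      using r u a e by (intro divide_left_mono) (auto simp: u_def mult_le_cancel_right1)
    finally have "1 / a \<le> ln ((u + e) * (1 - u) / (u * (1 - u - e)))"
      by (subst ln_ge_iff) (use u e in auto)
    then have "0 \<le> D u" using 1 by (simp add: D_def)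
    then show ?thesis using that u by blast
  qed
  have "continuous_on {a..u} D"
    unfolding D_def using a u e
    by (intro continuous_intros) auto
  then obtain t where "a \<le> t" "t \<le> u" "D t = 0"
    using IVT'[of D a 0 u] Da u by auto
  then show ?thesis
    using u by (intro that[of t]) (auto simp: D_def a_def)
qed

text \<open>One \<open>c\<close>, tuned to a single point \<open>u\<close>, has to serve all
  \<open>t\<close>. The function \<open>g\<close> is convex up to \<open>v\<close> and concave
  beyond: on the first part it is minimal at its stationary point \<open>u\<close>, on the second at
  an endpoint.\<close>

lemma hoeffding_tilt_exists:
  fixes e :: real
  assumes e: "0 < e" "e < 1"
  obtains c where "0 < c"
    "\<And>t. 0 < t \<Longrightarrow> t \<le> 1 - e \<Longrightarrow> 2 * e\<^sup>2 + ln (1 + c) \<le> (t + e) * ln (1 + c / t)"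
proof -
  obtain u where u: "(1 - e) / 2 \<le> u" "u \<le> 1 / 2" "u < 1 - e"
    and stat: "ln ((u + e) * (1 - u) / (u * (1 - u - e))) = e / (u * (1 - u))"
    using kl_stationary_point_exists[OF e] .
  define r where "r = 1 - u - e"
  have r: "0 < r" "r + e = 1 - u" and u0: "0 < u" "u < 1" using u e by (auto simp: r_def)
  \<comment> \<open>The maximiser over \<open>c\<close> of (u + e) ln (1 + c / u) - ln (1 + c). The
    maximum is the Bernoulli divergence of \<open>u + e\<close> from \<open>u\<close>, so
    \<open>gu\<close> below is Pinsker's inequality.\<close>
  define c where "c = e / r"
  have c: "0 < c" using r e by (simp add: c_def)
  define g where "g = (\<lambda>t. (t + e) * (ln (t + c) - ln t) - ln (1 + c))"
  define g' where "g' = (\<lambda>t. ln (t + c) - ln t - (t + e) * c / (t * (t + c)))"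
  define g'' where "g'' = (\<lambda>t. c * (e * c + t * (2 * e - c)) / (t * (t + c))\<^sup>2)"
  have ln1: "ln (t + c) - ln t = ln (1 + c / t)" if "0 < t" for t
    using that c by (subst ln_divide_pos[symmetric]) (auto simp: field_simps)
  have dg: "(g has_real_derivative g' t) (at t)" if "0 < t" for t
    unfolding g_def g'_def using that c
    by (auto intro!: derivative_eq_intros simp: divide_simps)
  have dg': "(g' has_real_derivative g'' t) (at t)" if "0 < t" for t
  proof -
    have "(g' has_real_derivative (1 / (t + c) - 1 / t
        - (c * (t * (t + c)) - (t + e) * c * (2 * t + c)) / (t * (t + c))\<^sup>2)) (at t)"
      unfolding g'_def using that c
      by (auto intro!: derivative_eq_intros simp: power2_eq_square)
    moreover have "1 / (t + c) - 1 / t = - (c * (t * (t + c))) / (t * (t + c))\<^sup>2"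
      using that c by (simp add: divide_simps power2_eq_square)
    ultimately show ?thesis
      by (simp add: g''_def diff_divide_distrib[symmetric] algebra_simps)
  qed
  have c1: "1 + c = (1 - u) / r"
    using r by (simp add: c_def field_simps)
  have cu: "1 + c / u = (u + e) * (1 - u) / (u * r)"
    using r u0 by (simp add: c_def field_simps) (simp add: r_def algebra_simps)
  \<comment> \<open>Envelope argument: as \<open>c\<close> is optimal at \<open>u\<close>, the slope
    of \<open>g\<close> there equals that of the divergence, which vanishes by
    \<open>stat\<close>.\<close>
  have g'u: "g' u = 0"
  proof -
    have "u + c = u * (1 + c / u)" using u0 by (simp add: field_simps)
    also have "\<dots> = (u + e) * (1 - u) / r" unfolding cu using u0 by simp
    finally have "(u + e) * c / (u * (u + c)) = e / (u * (1 - u))"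
      using u0 r e by (simp add: c_def divide_simps)
    then show ?thesis using stat cu ln1[OF u0(1)] by (simp add: g'_def r_def)
  qed
  have gu: "2 * e\<^sup>2 \<le> g u"
  proof -
    define A L C D where "A = ln (u + e)" and "L = ln (1 - u)" and "C = ln u" and "D = ln r"
    have "g u = (u + e) * (A + L - (C + D)) - (L - D)"
      unfolding g_def ln1[OF u0(1)] cu c1 A_def L_def C_def D_def using u0 r e
      by (simp add: ln_divide_pos ln_mult_pos)
    also have "\<dots> = (u + e) * (A - C) + (1 - u - e) * (D - L)"
      by (simp add: algebra_simps)
    also have "\<dots> = (u + e) * ln ((u + e) / u) + (1 - u - e) * ln ((1 - u - e) / (1 - u))"
      unfolding A_def L_def C_def D_def using u0 r e by (simp add: ln_divide_pos r_def)
    finally have "g u = (u + e) * ln ((u + e) / u) + (1 - u - e) * ln ((1 - u - e) / (1 - u))" .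
    then show ?thesis using bernoulli_pinsker[of u e] u0 u e by simp
  qed
  have gend: "2 * e\<^sup>2 \<le> g (1 - e)"
  proof -
    have "g (1 - e) = ln ((1 + c / (1 - e)) / (1 + c))"
      using c e by (simp add: g_def ln1 ln_divide_pos add_pos_pos)
    also have "(1 + c / (1 - e)) / (1 + c) = 1 + e\<^sup>2 / ((1 - e) * (1 - u))"
      unfolding c1 using r u0 e
      by (simp add: c_def divide_simps) (simp add: r_def algebra_simps power2_eq_square)
    finally have g1: "g (1 - e) = ln (1 + e\<^sup>2 / ((1 - e) * (1 - u)))" .
    have "(1 - e) * (1 - u) \<le> (1 - e) * ((1 + e) / 2)"
      using u e by (intro mult_left_mono) auto
    also have "\<dots> = (1 - e\<^sup>2) / 2" by (simp add: algebra_simps power2_eq_square)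
    finally have "e\<^sup>2 / ((1 - e\<^sup>2) / 2) \<le> e\<^sup>2 / ((1 - e) * (1 - u))"
      using e u0 by (intro divide_left_mono mult_pos_pos) (auto simp: abs_square_less_1)
    moreover have "(1 + e\<^sup>2) / (1 - e\<^sup>2) = 1 + e\<^sup>2 / ((1 - e\<^sup>2) / 2)"
      using e abs_square_less_1[of e] by (simp add: field_simps)
    ultimately have "ln ((1 + e\<^sup>2) / (1 - e\<^sup>2)) \<le> g (1 - e)"
      unfolding g1 using e abs_square_less_1[of e] by (intro ln_mono) (auto intro!: add_pos_nonneg)
    then show ?thesis
      using two_mult_le_ln_ratio[of "e\<^sup>2"] e abs_square_less_1[of e] by simp
  qed
  have c2: "2 * e < c"
  proof -
    have "e * (2 * r) < e * 1" using u e by (intro mult_strict_left_mono) (auto simp: r_def)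
    then show ?thesis using r by (simp add: c_def field_simps)
  qed
  \<comment> \<open>The point where the numerator of \<open>g''\<close>, linear in \<open>t\<close>
    with negative slope by \<open>c2\<close>, changes sign.\<close>
  define v where "v = e * c / (c - 2 * e)"
  have num: "0 \<le> e * c + t * (2 * e - c) \<longleftrightarrow> t \<le> v" for t
    using c2 by (simp add: v_def field_simps)
  \<comment> \<open>Up to positive factors this is (1 - 2 u) (u + e) \<ge> 0, so
    \<open>u \<le> 1 / 2\<close> is what puts \<open>u\<close> in the convex part.\<close>
  have uv: "u \<le> v"
  proof -
    have "(2 * u - 1) * (u + e) \<le> 0" using u u0 e by (intro mult_nonpos_nonneg) auto
    then have "0 \<le> e + u * (2 * r - 1)" by (simp add: r_def algebra_simps)
    then have "0 \<le> c * (e + u * (2 * r - 1))" using c by simp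
    also have "\<dots> = e * c + u * (2 * e - c)"
      using r by (simp add: c_def field_simps)
    finally show ?thesis using num by simp
  qed
  have left: "2 * e\<^sup>2 \<le> g t" if t: "0 < t" "t \<le> v" for t
  proof -
    have "g' u * (t - u) \<le> g t - g u"
    proof (rule f''_imp_f'[of "{0<..v}" g g' g''])
      show "0 \<le> g'' x" if "x \<in> {0<..v}" for x
        using that num[of x] c by (simp add: g''_def)
    qed (use dg dg' u0 uv t in auto)
    then show ?thesis using g'u gu by simp
  qed
  have "2 * e\<^sup>2 \<le> g t" if t: "0 < t" "t \<le> 1 - e" for t
  proof (cases "t \<le> v")
    case True
    then show ?thesis using left t by simp
  next
    case False
    have v: "0 < v" using uv u0 by simp
    have "concave_on {v..1 - e} g"
    proof (rule f''_le0_imp_concave[of _ g g' g''])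
      show "g'' x \<le> 0" if "x \<in> {v..1 - e}" for x
      proof -
        have "e * c + x * (2 * e - c) \<le> 0"
          using c2 v that by (simp add: v_def field_simps)
        then show ?thesis
          using c by (simp add: g''_def divide_nonpos_nonneg mult_nonneg_nonpos)
      qed
    qed (use dg dg' v in auto)
    then have cv: "convex_on {v..1 - e} (\<lambda>t. - g t)" by (simp add: concave_on_def)
    have "- g t \<le> max (- g v) (- g (1 - e))"
      using convex_on_le_max[OF cv, of t] False t by auto
    then show ?thesis using left[of v] v gend by auto
  qed
  then have "2 * e\<^sup>2 + ln (1 + c) \<le> (t + e) * ln (1 + c / t)" if "0 < t" "t \<le> 1 - e" for t
    using that ln1[OF that(1)] unfolding g_def by (metis add.commute le_diff_eq)
  then show ?thesis using that[OF c] by blast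
qed

text \<open>\<open>1 + c / t\<close> is a convex combination of 1 and \<open>1 + c / a\<close>, and
  ln is concave. In the peeling this carries a bound from the lower end of a slab to all its
  points.\<close>

lemma mult_ln_one_plus_divide_mono:
  fixes a c t :: real
  assumes "0 < a" "a \<le> t" "0 \<le> c"
  shows "a * ln (1 + c / a) \<le> t * ln (1 + c / t)"
proof -
  have "(1 - a / t) * ln 1 + a / t * ln (1 + c / a) \<le> ln ((1 - a / t) * 1 + a / t * (1 + c / a))"
    using concave_onD[OF ln_concave, of "a / t" 1 "1 + c / a"] assms by (simp add: add_pos_nonneg)
  also have "(1 - a / t) * 1 + a / t * (1 + c / a) = 1 + c / t"
    using assms by (simp add: field_simps)
  finally show ?thesis
    using assms by (simp add: field_simps)
qed

section \<open>The function h and its inverse\<close>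

lemma hfun_strict_mono:
  assumes "1 \<le> x" "x < y"
  shows "hfun x < hfun y"
proof (rule DERIV_pos_imp_increasing_open[OF assms(2)])
  fix z assume "x < z" "z < y"
  then have "(hfun has_real_derivative ln z) (at z)" "0 < ln z"
    unfolding hfun_def using assms by (auto intro!: derivative_eq_intros)
  then show "\<exists>D. (hfun has_real_derivative D) (at z) \<and> 0 < D" by blast
next
  show "continuous_on {x..y} hfun"
    unfolding hfun_def using assms by (auto intro!: continuous_intros)
qed

lemma
  assumes y: "0 < y"
  shows hinv_gt_1: "1 < hinv y" and hfun_hinv: "hfun (hinv y) = y"
proof -
  define b where "b = exp 2 + y"
  have b: "1 \<le> b" "y \<le> b" "2 \<le> ln b" "0 < b"
  proof -
    show "1 \<le> b" "y \<le> b" "0 < b" using y by (auto simp: b_def add_pos_pos intro: order_trans[of 1 "exp 2"])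
    show "2 \<le> ln b" using y by (subst ln_ge_iff) (auto simp: b_def add_pos_pos)
  qed
  have "b * 1 \<le> b * (ln b - 1)" using b by (intro mult_left_mono) auto
  then have "y \<le> hfun b" using b unfolding hfun_def by linarith
  moreover have "hfun 1 \<le> y" using y by (simp add: hfun_def)
  moreover have "continuous_on {1..b} hfun"
    unfolding hfun_def by (auto intro!: continuous_intros)
  ultimately obtain x where x: "1 \<le> x" "hfun x = y"
    using IVT'[of hfun 1 y b] b by auto
  have "x \<noteq> 1" using x y by (auto simp: hfun_def)
  then have "\<exists>!x. 1 < x \<and> hfun x = y"
    using x hfun_strict_mono by (intro ex1I[of _ x]) (auto, metis less_imp_le linorder_neqE order_less_irrefl)
  then have "1 < hinv y \<and> hfun (hinv y) = y"
    unfolding hinv_def by (rule theI')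
  then show "1 < hinv y" "hfun (hinv y) = y" by auto
qed

lemma hinv_mono:
  assumes "0 < y" "y \<le> z"
  shows "hinv y \<le> hinv z"
proof (rule ccontr)
  assume "\<not> hinv y \<le> hinv z"
  then have "hfun (hinv z) < hfun (hinv y)"
    using assms hinv_gt_1[of z] by (intro hfun_strict_mono) auto
  then show False using assms by (simp add: hfun_hinv)
qed

lemma inverse_squares_sums_kappa: "(\<lambda>n. 1 / (real n + 1)\<^sup>2) sums kappa"
  using inverse_squares_sums by (simp add: kappa_def add.commute)

lemma kappa_gt_1: "1 < kappa"
proof -
  note s = inverse_squares_sums_kappa
  have "(\<Sum>n<2. 1 / (real n + 1)\<^sup>2) \<le> kappa"
    using sum_le_suminf[OF sums_summable[OF s], of "{..<2}"] sums_unique[OF s] by simp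
  then show ?thesis by (simp add: numeral_2_eq_2)
qed

section \<open>The maximal inequality\<close>

locale superuniform_pvalues = prob_space +
  fixes I :: "'i set" and p :: "'i \<Rightarrow> 'a \<Rightarrow> real"
  assumes finite_I: "finite I"
    and indep: "indep_vars (\<lambda>_. borel) p I"
    and superuniform: "\<And>i t. i \<in> I \<Longrightarrow> 0 \<le> t \<Longrightarrow> t \<le> 1 \<Longrightarrow> prob {x \<in> space M. p i x \<le> t} \<le> t"
begin

definition below :: "real \<Rightarrow> 'a \<Rightarrow> nat" where
  "below t x = card {i \<in> I. p i x \<le> t}"

text \<open>Coordinates in \<open>S\<close> are treated as if they were zero.\<close>
definition crossing :: "real \<Rightarrow> real \<Rightarrow> real \<Rightarrow> 'i set \<Rightarrow> ('i \<Rightarrow> real) \<Rightarrow> bool" where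
  "crossing c B t S f \<longleftrightarrow> B \<le> (\<Prod>i\<in>I. if i \<in> S \<or> f i \<le> t then 1 + c / t else 1)"

text \<open>As \<open>t\<close> decreases from 1, the largest crossing point in \<open>T\<close> is
  the first one met, so it acts as a stopping time of the reverse process.\<close>

definition last_crossing :: "real \<Rightarrow> real \<Rightarrow> real set \<Rightarrow> real \<Rightarrow> 'i set \<Rightarrow> ('i \<Rightarrow> real) \<Rightarrow> bool" where
  "last_crossing c B T t S f \<longleftrightarrow> crossing c B t S f \<and> (\<forall>s\<in>T. t < s \<longrightarrow> \<not> crossing c B s S f)"

lemma p_measurable [measurable]: "i \<in> I \<Longrightarrow> p i \<in> borel_measurable M"
  using indep by (auto simp: indep_vars_def)

lemma prod_if_eq_power_below:
  "(\<Prod>i\<in>I. if p i x \<le> t then a else 1) = a ^ below t x" for a :: real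
  using finite_I by (simp add: below_def prod.inter_filter[symmetric])

lemma prob_all_below_le:
  assumes "S \<subseteq> I" "0 \<le> t" "t \<le> 1"
  shows "prob {x \<in> space M. \<forall>i\<in>S. p i x \<le> t} \<le> t ^ card S"
proof (cases "S = {}")
  case True
  then show ?thesis by simp
next
  case False
  have fin: "finite S" using assms finite_I finite_subset by blast
  have "{x \<in> space M. \<forall>i\<in>S. p i x \<le> t} = (\<Inter>i\<in>S. p i -` {..t} \<inter> space M)"
    using False by auto
  then have "prob {x \<in> space M. \<forall>i\<in>S. p i x \<le> t} = (\<Prod>i\<in>S. prob (p i -` {..t} \<inter> space M))"
    using indep_varsD[OF indep False fin assms(1), of "\<lambda>_. {..t}"] by simp
  also have "\<dots> \<le> (\<Prod>i\<in>S. t)"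
  proof (rule prod_mono)
    fix i assume "i \<in> S"
    then have "prob {x \<in> space M. p i x \<le> t} \<le> t"
      using assms superuniform by auto
    moreover have "p i -` {..t} \<inter> space M = {x \<in> space M. p i x \<le> t}" by auto
    ultimately show "0 \<le> prob (p i -` {..t} \<inter> space M) \<and> prob (p i -` {..t} \<inter> space M) \<le> t"
      by simp
  qed
  finally show ?thesis by simp
qed

section \<open>Dependence of crossings on the coordinates\<close>

lemma crossing_cong:
  assumes "\<And>i. i \<in> I - S \<Longrightarrow> f i = g i"
  shows "crossing c B t S f \<longleftrightarrow> crossing c B t S g"
proof -
  have "(\<Prod>i\<in>I. if i \<in> S \<or> f i \<le> t then 1 + c / t else 1)
      = (\<Prod>i\<in>I. if i \<in> S \<or> g i \<le> t then 1 + c / t else 1)"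
    using assms by (intro prod.cong) auto
  then show ?thesis by (simp add: crossing_def)
qed

lemma last_crossing_cong:
  assumes "\<And>i. i \<in> I - S \<Longrightarrow> f i = g i"
  shows "last_crossing c B T t S f \<longleftrightarrow> last_crossing c B T t S g"
  using crossing_cong[of S f g, OF assms] by (simp add: last_crossing_def)

text \<open>Only points \<open>s \<ge> t\<close> enter the condition, and there the coordinates in
  \<open>S\<close> count as below anyway.\<close>

lemma last_crossing_zero_coordinates:
  assumes "\<And>i. i \<in> S \<Longrightarrow> f i \<le> t"
  shows "last_crossing c B T t {} f \<longleftrightarrow> last_crossing c B T t S f"
proof -
  have "crossing c B s {} f \<longleftrightarrow> crossing c B s S f" if "t \<le> s" for s
  proof -
    have "(\<Prod>i\<in>I. if i \<in> {} \<or> f i \<le> s then 1 + c / s else 1)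
      = (\<Prod>i\<in>I. if i \<in> S \<or> f i \<le> s then 1 + c / s else 1)"
      using assms that by (intro prod.cong) force+
    then show ?thesis by (simp add: crossing_def)
  qed
  then show ?thesis by (auto simp: last_crossing_def)
qed

lemma last_crossing_unique:
  assumes "last_crossing c B T s S f" "last_crossing c B T t S f" "s \<in> T" "t \<in> T"
  shows "s = t"
  using assms unfolding last_crossing_def by (metis linorder_neqE)

text \<open>General in \<open>f\<close> and \<open>N\<close> to cover both \<open>M\<close> and the
  product space of the coordinates outside \<open>S\<close>.\<close>

lemma last_crossing_measurable:
  assumes "finite T" "\<And>i. i \<in> I - S \<Longrightarrow> (\<lambda>x. f x i) \<in> borel_measurable N"
  shows "{x \<in> space N. last_crossing c B T t S (f x)} \<in> sets N"
proof -
  have [measurable]: "Measurable.pred N (\<lambda>x. i \<in> S \<or> f x i \<le> s)" if "i \<in> I" for i s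
    using assms(2)[of i] that by (cases "i \<in> S") auto
  have "(\<lambda>x. \<Prod>i\<in>I. if i \<in> S \<or> f x i \<le> s then 1 + c / s else 1) \<in> borel_measurable N" for s
    by (intro borel_measurable_prod) measurable
  then have [measurable]: "Measurable.pred N (\<lambda>x. crossing c B s S (f x))" for s
    unfolding crossing_def by measurable
  show ?thesis
    unfolding last_crossing_def using assms(1) by measurable
qed

text \<open>By \<open>last_crossing_cong\<close> the first event is determined by coordinates
  outside \<open>S\<close>, the second by those in \<open>S\<close>, and the two restrictions are
  independent.\<close>

lemma prob_last_crossing_indep:
  assumes "finite T" "S \<subseteq> I"
  shows "prob {x \<in> space M. last_crossing c B T t S (\<lambda>i. p i x) \<and> (\<forall>i\<in>S. p i x \<le> t)}
    = prob {x \<in> space M. \<forall>i\<in>S. p i x \<le> t} * prob {x \<in> space M. last_crossing c B T t S (\<lambda>i. p i x)}"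
proof -
  let ?X = "\<lambda>x. restrict (\<lambda>i. p i x) S" and ?Y = "\<lambda>x. restrict (\<lambda>i. p i x) (I - S)"
  let ?MX = "PiM S (\<lambda>_. borel :: real measure)" and ?MY = "PiM (I - S) (\<lambda>_. borel :: real measure)"
  let ?A = "{f \<in> space ?MX. \<forall>i\<in>S. f i \<le> t}"
  let ?B = "{f \<in> space ?MY. last_crossing c B T t S f}"
  have fin: "finite S" using assms finite_I finite_subset by blast
  have "indep_var ?MX ?X ?MY ?Y"
    using assms by (intro indep_var_restrict[OF indep]) auto
  moreover have "?A \<in> sets ?MX"
    using fin by measurable
  moreover have "?B \<in> sets ?MY"
    using assms(1) by (intro last_crossing_measurable) auto
  ultimately have "prob ((\<lambda>x. (?X x, ?Y x)) -` (?A \<times> ?B) \<inter> space M)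
      = prob (?X -` ?A \<inter> space M) * prob (?Y -` ?B \<inter> space M)"
    by (rule indep_varD)
  moreover have lc: "last_crossing c B T t S (?Y x) \<longleftrightarrow> last_crossing c B T t S (\<lambda>i. p i x)" for x
    by (rule last_crossing_cong) auto
  have "?X -` ?A \<inter> space M = {x \<in> space M. \<forall>i\<in>S. p i x \<le> t}"
    by (auto simp: space_PiM)
  moreover have "?Y -` ?B \<inter> space M = {x \<in> space M. last_crossing c B T t S (\<lambda>i. p i x)}"
    using lc by (auto simp: space_PiM)
  moreover have "(\<lambda>x. (?X x, ?Y x)) -` (?A \<times> ?B) \<inter> space M
      = {x \<in> space M. last_crossing c B T t S (\<lambda>i. p i x) \<and> (\<forall>i\<in>S. p i x \<le> t)}"
    using lc by (auto simp: space_PiM)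
  ultimately show ?thesis by simp
qed

lemma sum_prob_last_crossing_le_1:
  assumes "finite T"
  shows "(\<Sum>t\<in>T. prob {x \<in> space M. last_crossing c B T t S (\<lambda>i. p i x)}) \<le> 1"
proof -
  let ?E = "\<lambda>t. {x \<in> space M. last_crossing c B T t S (\<lambda>i. p i x)}"
  have "disjoint_family_on ?E T"
    using last_crossing_unique by (fastforce simp: disjoint_family_on_def)
  then have "(\<Sum>t\<in>T. prob (?E t)) = prob (\<Union>t\<in>T. ?E t)"
    using assms
    by (intro finite_measure_finite_Union[symmetric])
       (auto intro!: last_crossing_measurable)
  then show ?thesis by simp
qed

lemma crossing_power: "crossing c B t {} (\<lambda>i. p i x) \<longleftrightarrow> B \<le> (1 + c / t) ^ below t x"
  using prod_if_eq_power_below[of x t "1 + c / t"] by (simp add: crossing_def)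

text \<open>Each factor of the power is 1 plus \<open>c / t\<close> times an indicator; multiplying
  out, the empty subset contributes the 1. Removing it yields \<open>B - 1\<close> instead of
  \<open>B\<close> in the maximal inequality.\<close>

lemma power_below_minus_1_eq_sum:
  assumes "0 < t"
  shows "(1 + c / t) ^ below t x - 1
    = (\<Sum>S\<in>Pow I - {{}}. (c / t) ^ card S * (if \<forall>i\<in>S. p i x \<le> t then 1 else 0))"
proof -
  have "(1 + c / t) ^ below t x = (\<Prod>i\<in>I. (if p i x \<le> t then c / t else 0) + 1)"
    unfolding prod_if_eq_power_below[symmetric] by (intro prod.cong) auto
  also have "\<dots> = (\<Sum>S\<in>Pow I. (\<Prod>i\<in>S. if p i x \<le> t then c / t else 0))"
    by (subst prod_add[OF finite_I]) simp
  also have "\<dots> = (\<Sum>S\<in>Pow I. (c / t) ^ card S * (if \<forall>i\<in>S. p i x \<le> t then 1 else 0))"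
  proof (rule sum.cong[OF refl])
    fix S assume "S \<in> Pow I"
    then have "finite S" using finite_I finite_subset by auto
    then show "(\<Prod>i\<in>S. if p i x \<le> t then c / t else 0)
        = (c / t) ^ card S * (if \<forall>i\<in>S. p i x \<le> t then 1 else 0)"
      by (auto intro!: prod_zero)
  qed
  also have "\<dots> = (\<Sum>S\<in>Pow I - {{}}. (c / t) ^ card S * (if \<forall>i\<in>S. p i x \<le> t then 1 else 0)) + 1"
    using finite_I by (subst sum.remove[of _ "{}"]) auto
  finally show ?thesis by simp
qed

text \<open>The expectation of the process at its last crossing time splits over the subsets of
  coordinates below that time. For each subset, the time depends on the other coordinates only,
  so independence replaces the indicator by its superuniform bound.\<close>
lemma maximal_inequality_finite:
  assumes c: "0 < c" and T: "finite T" "T \<subseteq> {0<..1}"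
  shows "(B - 1) * prob {x \<in> space M. \<exists>t\<in>T. B \<le> (1 + c / t) ^ below t x} \<le> (1 + c) ^ card I - 1"
proof -
  let ?E = "\<lambda>S t. {x \<in> space M. last_crossing c B T t S (\<lambda>i. p i x)}"
  let ?F = "\<lambda>S t. {x \<in> space M. last_crossing c B T t S (\<lambda>i. p i x) \<and> (\<forall>i\<in>S. p i x \<le> t)}"
  let ?P = "Pow I - {{}}"
  have E_meas [measurable]: "?E S t \<in> sets M" for S t
    using T by (intro last_crossing_measurable) auto
  have below_meas: "{x \<in> space M. \<forall>i\<in>S. p i x \<le> t} \<in> sets M" if "S \<in> ?P" for S t
  proof -
    have [measurable]: "i \<in> S \<Longrightarrow> p i \<in> borel_measurable M" for i using that by auto
    have "finite S" using that finite_I finite_subset by auto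
    then show ?thesis by measurable
  qed
  have F_meas: "?F S t \<in> sets M" if "S \<in> ?P" for S t
    using sets.Int[OF E_meas[of t S] below_meas[OF that, of t]]
    by (auto intro: back_subst[of "\<lambda>A. A \<in> sets M"])
  \<comment> \<open>Exchanges the actual last crossing for the one that ignores the values in
    \<open>S\<close>, to which independence applies.\<close>
  have F_eq: "?F S t = {x \<in> ?E {} t. \<forall>i\<in>S. p i x \<le> t}" for S t
    using last_crossing_zero_coordinates[of S _ t c B T] by auto
  have step: "(B - 1) * prob (?E {} t) \<le> (\<Sum>S\<in>?P. (c / t) ^ card S * prob (?F S t))" if t: "t \<in> T" for t
  proof -
    have t0: "0 < t" using t T by auto
    have "(B - 1) * prob (?E {} t) = expectation (\<lambda>x. (B - 1) * indicator (?E {} t) x)"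
      by (simp add: Int_absorb2)
    also have "\<dots> \<le> expectation (\<lambda>x. \<Sum>S\<in>?P. (c / t) ^ card S * indicator (?F S t) x)"
    proof (rule integral_mono)
      show "integrable M (\<lambda>x. \<Sum>S\<in>?P. (c / t) ^ card S * indicator (?F S t) x)"
        using F_meas by (intro Bochner_Integration.integrable_sum integrable_mult_right integrable_real_indicator)
          (auto simp: emeasure_eq_measure)
      show "integrable M (\<lambda>x. (B - 1) * indicator (?E {} t) x)"
        using E_meas[of t "{}"]
        by (intro integrable_mult_right integrable_real_indicator) (auto simp: emeasure_eq_measure)
      fix x assume x: "x \<in> space M"
      show "(B - 1) * indicator (?E {} t) x \<le> (\<Sum>S\<in>?P. (c / t) ^ card S * indicator (?F S t) x)"
      proof (cases "x \<in> ?E {} t")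
        case True
        then have "B - 1 \<le> (1 + c / t) ^ below t x - 1"
          by (auto simp: last_crossing_def crossing_power)
        also have "\<dots> = (\<Sum>S\<in>?P. (c / t) ^ card S * indicator (?F S t) x)"
          unfolding power_below_minus_1_eq_sum[OF t0] F_eq using True x
          by (intro sum.cong) (auto simp: indicator_def)
        finally show ?thesis using True by simp
      next
        case False
        then show ?thesis using c t0 by (auto intro!: sum_nonneg)
      qed
    qed
    also have "\<dots> = (\<Sum>S\<in>?P. (c / t) ^ card S * prob (?F S t))"
      using F_meas by (subst Bochner_Integration.integral_sum)
        (auto intro!: sum.cong integrable_real_indicator simp: emeasure_eq_measure Int_absorb2)
    finally show ?thesis .
  qed
  have "{x \<in> space M. \<exists>t\<in>T. B \<le> (1 + c / t) ^ below t x} = (\<Union>t\<in>T. ?E {} t)"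
  proof (intro equalityI subsetI)
    fix x assume x: "x \<in> {x \<in> space M. \<exists>t\<in>T. B \<le> (1 + c / t) ^ below t x}"
    let ?C = "{t \<in> T. B \<le> (1 + c / t) ^ below t x}"
    have C: "finite ?C" "?C \<noteq> {}" using T x by auto
    then have "Max ?C \<in> ?C" by (rule Max_in)
    moreover have "\<not> B \<le> (1 + c / s) ^ below s x" if "s \<in> T" "Max ?C < s" for s
      using Max_ge[OF C(1), of s] that by auto
    ultimately have "last_crossing c B T (Max ?C) {} (\<lambda>i. p i x)"
      unfolding last_crossing_def crossing_power by auto
    then show "x \<in> (\<Union>t\<in>T. ?E {} t)" using \<open>Max ?C \<in> ?C\<close> x by blast
  qed (auto simp: last_crossing_def crossing_power)
  moreover have "disjoint_family_on (?E {}) T"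
    using last_crossing_unique by (fastforce simp: disjoint_family_on_def)
  ultimately have "(B - 1) * prob {x \<in> space M. \<exists>t\<in>T. B \<le> (1 + c / t) ^ below t x}
      = (B - 1) * (\<Sum>t\<in>T. prob (?E {} t))"
    using T by (simp add: finite_measure_finite_Union image_subset_iff)
  also have "\<dots> = (\<Sum>t\<in>T. (B - 1) * prob (?E {} t))" by (simp add: sum_distrib_left)
  also have "\<dots> \<le> (\<Sum>t\<in>T. \<Sum>S\<in>?P. (c / t) ^ card S * prob (?F S t))"
    by (intro sum_mono step)
  also have "\<dots> = (\<Sum>S\<in>?P. \<Sum>t\<in>T. (c / t) ^ card S * prob (?F S t))"
    by (rule sum.swap)
  \<comment> \<open>The bound \<open>t ^ card S\<close> cancels the power of \<open>1 / t\<close>.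
    For fixed \<open>S\<close> the remaining events are disjoint in \<open>t\<close>, so their
    probabilities sum to at most 1.\<close>
  also have "\<dots> \<le> (\<Sum>S\<in>?P. \<Sum>t\<in>T. c ^ card S * prob (?E S t))"
  proof (intro sum_mono)
    fix S t assume S: "S \<in> ?P" and t: "t \<in> T"
    then have t: "0 < t" "t \<le> 1" and SI: "S \<subseteq> I" using T by auto
    have "(c / t) ^ card S * prob (?F S t)
        \<le> (c / t) ^ card S * (t ^ card S * prob (?E S t))"
      unfolding prob_last_crossing_indep[OF T(1) SI] using prob_all_below_le[OF SI] c t
      by (intro mult_left_mono mult_right_mono) auto
    also have "\<dots> = c ^ card S * prob (?E S t)"
      using t by (simp add: power_divide)
    finally show "(c / t) ^ card S * prob (?F S t) \<le> c ^ card S * prob (?E S t)" .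
  qed
  also have "\<dots> = (\<Sum>S\<in>?P. c ^ card S * (\<Sum>t\<in>T. prob (?E S t)))"
    by (simp add: sum_distrib_left)
  also have "\<dots> \<le> (\<Sum>S\<in>?P. c ^ card S * 1)"
    using c by (intro sum_mono mult_left_mono sum_prob_last_crossing_le_1 T) auto
  also have "\<dots> = (\<Sum>S\<in>Pow I. c ^ card S) - 1"
    using finite_I by (simp add: sum_diff)
  also have "(\<Sum>S\<in>Pow I. c ^ card S) = (1 + c) ^ card I"
    using prod_add[OF finite_I, of "\<lambda>_. c" "\<lambda>_. 1"] by (simp add: add.commute)
  finally show ?thesis .
qed

text \<open>For each value of \<open>below\<close> the crossing condition bounds \<open>t\<close> from above, so it suffices to
  look at these finitely many bounds.\<close>
lemma
  assumes c: "0 < c" and B: "1 < B"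
  shows crossing_event_sets:
      "{x \<in> space M. \<exists>t. 0 < t \<and> t \<le> 1 \<and> B \<le> (1 + c / t) ^ below t x} \<in> sets M" (is "?A \<in> _")
    and maximal_inequality:
      "prob {x \<in> space M. \<exists>t. 0 < t \<and> t \<le> 1 \<and> B \<le> (1 + c / t) ^ below t x}
        \<le> ((1 + c) ^ card I - 1) / (B - 1)"
proof -
  \<comment> \<open>Solves (1 + c / t)^k = B for \<open>t\<close>, capped at 1. A crossing at
    \<open>t\<close> with count \<open>k\<close> has \<open>t \<le> b k\<close>, and the count at
    \<open>b k\<close> is then at least \<open>k\<close>, so \<open>b k\<close> crosses too. Count 0
    never crosses as \<open>1 < B\<close>.\<close>
  define b where "b = (\<lambda>k::nat. min 1 (c / (root k B - 1)))"
  define T where "T = b ` {1..card I}"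
  have root1: "1 < root k B" if "1 \<le> k" for k
    using real_root_less_mono[of k 1 B] B that by simp
  have T: "finite T" "T \<subseteq> {0<..1}"
    using c root1 by (auto simp: T_def b_def)
  let ?E = "{x \<in> space M. \<exists>t\<in>T. B \<le> (1 + c / t) ^ below t x}"
  have "?A \<subseteq> ?E"
  proof
    fix x assume "x \<in> ?A"
    then obtain t where x: "x \<in> space M" and t: "0 < t" "t \<le> 1" "B \<le> (1 + c / t) ^ below t x"
      by auto
    define k where "k = below t x"
    have k1: "1 \<le> k"
      using t(3) B by (cases k) (auto simp: k_def)
    have k2: "k \<le> card I" unfolding k_def below_def by (intro card_mono finite_I) auto
    have "root k B \<le> 1 + c / t"
      using real_root_le_mono[of k, OF _ t(3)] k1 c t by (simp add: k_def real_root_power_cancel)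
    then have "t \<le> c / (root k B - 1)"
      using root1[OF k1] t by (simp add: field_simps)
    then have tb: "t \<le> b k" using t by (simp add: b_def)
    have b0: "0 < b k" using c root1[OF k1] by (simp add: b_def)
    have "root k B \<le> 1 + c / b k"
    proof -
      have "b k \<le> c / (root k B - 1)" by (simp add: b_def)
      then show ?thesis using root1[OF k1] b0 by (simp add: field_simps)
    qed
    then have "root k B ^ k \<le> (1 + c / b k) ^ k"
      using root1[OF k1] by (intro power_mono) auto
    then have "B \<le> (1 + c / b k) ^ k"
      using k1 B by simp
    also have "\<dots> \<le> (1 + c / b k) ^ below (b k) x"
      unfolding k_def below_def using tb finite_I c b0
      by (intro power_increasing card_mono) (auto simp: k_def below_def)
    finally show "x \<in> ?E" using x k1 k2 by (auto simp: T_def)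
  qed
  moreover have "?E \<subseteq> ?A" using T(2) by force
  ultimately have AE: "?A = ?E" by (rule equalityI)
  have "?E \<in> sets M"
  proof -
    have "(\<lambda>x. \<Prod>i\<in>I. if p i x \<le> t then 1 + c / t else 1) \<in> borel_measurable M" for t
      by (intro borel_measurable_prod) measurable
    then have [measurable]: "(\<lambda>x. (1 + c / t) ^ below t x) \<in> borel_measurable M" for t
      by (simp add: prod_if_eq_power_below)
    show ?thesis using T(1) by measurable
  qed
  then show "?A \<in> sets M" unfolding AE .
  show "prob ?A \<le> ((1 + c) ^ card I - 1) / (B - 1)"
    unfolding AE using maximal_inequality_finite[OF c T, of B] B by (simp add: field_simps)
qed

section \<open>Boundary crossing probabilities\<close>

lemma below_le_card: "below t x \<le> card I"
  unfolding below_def by (intro card_mono finite_I) auto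

text \<open>Crossings concern only \<open>t > 0\<close>; this takes care of null p-values equal to
  zero.\<close>

lemma prob_some_nonpos_eq_0: "prob {x \<in> space M. \<exists>i\<in>I. p i x \<le> 0} = 0"
proof -
  have "prob (\<Union>i\<in>I. {x \<in> space M. p i x \<le> 0}) \<le> (\<Sum>i\<in>I. prob {x \<in> space M. p i x \<le> 0})"
    using finite_I by (intro measure_UNION_le) measurable
  also have "\<dots> \<le> (\<Sum>i\<in>I. 0)"
    by (intro sum_mono superuniform) auto
  finally have "prob (\<Union>i\<in>I. {x \<in> space M. p i x \<le> 0}) = 0"
    using measure_nonneg[of M "\<Union>i\<in>I. {x \<in> space M. p i x \<le> 0}"] by simp
  moreover have "(\<Union>i\<in>I. {x \<in> space M. p i x \<le> 0}) = {x \<in> space M. \<exists>i\<in>I. p i x \<le> 0}"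
    by auto
  ultimately show ?thesis by simp
qed

text \<open>Since \<open>d < 1\<close>, (d B - 1) / (B - 1) \<le> d: the two subtracted ones cost
  nothing.\<close>

lemma
  assumes c: "0 < c" and d: "0 < d" "d < 1" and B: "(1 + c) ^ card I \<le> d * B"
  shows crossing_event_sets': "{x \<in> space M. \<exists>t. 0 < t \<and> t \<le> 1 \<and> B \<le> (1 + c / t) ^ below t x} \<in> sets M"
    and maximal_inequality_ratio:
      "prob {x \<in> space M. \<exists>t. 0 < t \<and> t \<le> 1 \<and> B \<le> (1 + c / t) ^ below t x} \<le> d"
proof -
  have "1 \<le> (1 + c) ^ card I" using c by simp
  with B have dB: "1 \<le> d * B" by linarith
  have B0: "0 < B"
    using dB d by (smt (verit) mult_nonneg_nonpos)
  then have "d * B < B" using d by simp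
  with dB have B1: "1 < B" by linarith
  show "{x \<in> space M. \<exists>t. 0 < t \<and> t \<le> 1 \<and> B \<le> (1 + c / t) ^ below t x} \<in> sets M"
    using c B1 by (rule crossing_event_sets)
  have "((1 + c) ^ card I - 1) / (B - 1) \<le> d"
    using B B1 d by (simp add: field_simps)
  with maximal_inequality[OF c B1]
  show "prob {x \<in> space M. \<exists>t. 0 < t \<and> t \<le> 1 \<and> B \<le> (1 + c / t) ^ below t x} \<le> d"
    by linarith
qed

lemma exp_le_power_below:
  assumes "0 < t" "0 < c" "y \<le> real (below t x)"
  shows "exp (y * ln (1 + c / t)) \<le> (1 + c / t) ^ below t x"
proof -
  have pos: "0 < 1 + c / t" "0 \<le> ln (1 + c / t)" using assms by (auto simp: add_pos_pos)
  have "exp (y * ln (1 + c / t)) \<le> exp (real (below t x) * ln (1 + c / t))"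
    using assms pos by (simp add: mult_right_mono)
  also have "\<dots> = (1 + c / t) ^ below t x"
    using pos by (simp add: exp_of_nat_mult)
  finally show ?thesis .
qed

text \<open>The one-sided DKW inequality with Massart's constant, for every \<open>\<alpha>\<close>.\<close>
lemma prob_exceed_hoeffding_boundary_le:
  assumes m: "card I \<le> m" and \<alpha>: "0 < \<alpha>" "\<alpha> < 1"
    and A: "A \<subseteq> {x \<in> space M. \<exists>t. 0 < t \<and> t \<le> 1 \<and>
      real m * t + sqrt (real m / 2 * ln (1 / \<alpha>)) < real (below t x)}"
  shows "prob A \<le> \<alpha>"
proof (cases "m = 0")
  case True
  then have "A = {}" using A below_le_card m \<alpha> by fastforce
  then show ?thesis using \<alpha> by simp
next
  case False
  \<comment> \<open>The deviation with exp (- 2 m e^2) = \<alpha>; the boundary becomes m (t +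
    e).\<close>
  define e where "e = sqrt (ln (1 / \<alpha>) / (2 * real m))"
  have L: "0 < ln (1 / \<alpha>)" using \<alpha> by simp
  have e0: "0 < e" using L False by (simp add: e_def)
  have e2: "real m * (2 * e\<^sup>2) = ln (1 / \<alpha>)"
    using L False by (simp add: e_def)
  have "sqrt (real m / 2 * ln (1 / \<alpha>)) = real m * e"
  proof (rule real_sqrt_unique)
    show "(real m * e)\<^sup>2 = real m / 2 * ln (1 / \<alpha>)"
      using e2 by (simp add: power_mult_distrib power2_eq_square[of "real m"] field_simps)
  qed (use e0 in simp)
  with A have A: "A \<subseteq> {x \<in> space M. \<exists>t. 0 < t \<and> t \<le> 1 \<and> real m * (t + e) < real (below t x)}"
    by (simp add: algebra_simps)
  \<comment> \<open>The count is at most \<open>m\<close>, so exceedance happens only in the range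
    of \<open>t\<close> covered by the tilt, and never if \<open>e \<ge> 1\<close>.\<close>
  have te: "t + e < 1" if "real m * (t + e) < real (below t x)" for t x
  proof -
    have "real (below t x) \<le> real m * 1" using below_le_card[of t x] m by simp
    with that have "real m * (t + e) < real m * 1" by linarith
    then show ?thesis using False by simp
  qed
  show ?thesis
  proof (cases "e < 1")
    case False
    then have "A = {}" using A te by fastforce
    then show ?thesis using \<alpha> by simp
  next
    case True
    obtain c where c: "0 < c"
      and tilt: "\<And>t. 0 < t \<Longrightarrow> t \<le> 1 - e \<Longrightarrow> 2 * e\<^sup>2 + ln (1 + c) \<le> (t + e) * ln (1 + c / t)"
      using hoeffding_tilt_exists[OF e0 True] by blast
    define B where "B = (1 + c) ^ m / \<alpha>"
    have B: "B = exp (real m * (2 * e\<^sup>2 + ln (1 + c)))"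
      using \<alpha> c e2 by (simp add: B_def distrib_left exp_add exp_of_nat_mult)
    let ?E = "{x \<in> space M. \<exists>t. 0 < t \<and> t \<le> 1 \<and> B \<le> (1 + c / t) ^ below t x}"
    have "A \<subseteq> ?E"
    proof
      fix x assume "x \<in> A"
      with A obtain t where x: "x \<in> space M" and t: "0 < t" "t \<le> 1"
        and lt: "real m * (t + e) < real (below t x)" by auto
      have "B \<le> exp (real m * (t + e) * ln (1 + c / t))"
        unfolding B using mult_left_mono[OF tilt[OF t(1)], of "real m"] te[OF lt]
        by (simp add: mult.assoc)
      also have "\<dots> \<le> (1 + c / t) ^ below t x"
        using t c lt by (intro exp_le_power_below) auto
      finally show "x \<in> ?E" using x t by auto
    qed
    moreover have cond: "(1 + c) ^ card I \<le> \<alpha> * B"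
      using c m \<alpha> by (simp add: B_def power_increasing)
    ultimately have "prob A \<le> prob ?E"
      using c \<alpha> by (intro finite_measure_mono crossing_event_sets') auto
    also have "\<dots> \<le> \<alpha>" using c \<alpha> cond by (rule maximal_inequality_ratio)
    finally show ?thesis .
  qed
qed

text \<open>Letting \<open>c\<close> tend to zero linearises the process to \<open>below t x / t\<close>.\<close>
lemma prob_exceed_simes_boundary_le:
  assumes m: "card I \<le> m" "0 < m" and \<alpha>: "0 < \<alpha>"
    and A: "A \<subseteq> {x \<in> space M. \<exists>t. 0 < t \<and> t \<le> 1 \<and> real m * t / \<alpha> \<le> real (below t x)}"
  shows "prob A \<le> \<alpha>"
proof -
  have bound: "prob A \<le> \<alpha> / real m * (((1 + c) ^ card I - 1) / c)" if c: "0 < c" for c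
  proof -
    \<comment> \<open>The value on the boundary of 1 + N c / t, which by Bernoulli's inequality is a
      lower bound for the power with exponent N.\<close>
    define B where "B = 1 + c * real m / \<alpha>"
    have B: "1 < B" using c m \<alpha> by (simp add: B_def)
    let ?E = "{x \<in> space M. \<exists>t. 0 < t \<and> t \<le> 1 \<and> B \<le> (1 + c / t) ^ below t x}"
    have "A \<subseteq> ?E"
    proof
      fix x assume "x \<in> A"
      with A obtain t where x: "x \<in> space M" and t: "0 < t" "t \<le> 1"
        and le: "real m * t / \<alpha> \<le> real (below t x)" by auto
      have "c * real m / \<alpha> = (real m * t / \<alpha>) * (c / t)" using t by simp
      also have "\<dots> \<le> real (below t x) * (c / t)"
        using le c t by (intro mult_right_mono) auto
      finally have "B \<le> 1 + real (below t x) * (c / t)" by (simp add: B_def)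
      also have "\<dots> \<le> (1 + c / t) ^ below t x"
        using c t by (intro Bernoulli_inequality) (auto intro: order_trans[of _ 0])
      finally show "x \<in> ?E" using x t by auto
    qed
    then have "prob A \<le> prob ?E"
      using c B by (intro finite_measure_mono crossing_event_sets)
    also have "\<dots> \<le> ((1 + c) ^ card I - 1) / (B - 1)"
      using c B by (rule maximal_inequality)
    also have "\<dots> = \<alpha> / real m * (((1 + c) ^ card I - 1) / c)"
      by (simp add: B_def mult_ac)
    finally show ?thesis .
  qed
  have "((\<lambda>c::real. (1 + c) ^ card I) has_real_derivative real (card I)) (at 0)"
    by (auto intro!: derivative_eq_intros)
  then have "((\<lambda>c::real. ((1 + c) ^ card I - 1) / c) \<longlongrightarrow> real (card I)) (at_right 0)"
    unfolding DERIV_def by (auto intro: filterlim_mono[OF _ order_refl] simp: at_le)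
  then have "((\<lambda>c::real. \<alpha> / real m * (((1 + c) ^ card I - 1) / c)) \<longlongrightarrow> \<alpha> / real m * real (card I)) (at_right 0)"
    by (intro tendsto_intros)
  then have "prob A \<le> \<alpha> / real m * real (card I)"
    by (rule tendsto_lowerbound) (rule eventually_mono[OF eventually_at_right_less bound], auto)
  also have "\<dots> \<le> \<alpha> / real m * real m"
    using m \<alpha> by (intro mult_left_mono) auto
  finally show ?thesis using m by simp
qed

text \<open>Peeling over the dyadic slabs \<open>(2\<^bsup>-j-1\<^esup>, 2\<^bsup>-j\<^esup>]\<close>, the \<open>j\<close>-th of which gets the share
  \<open>\<alpha> / (\<kappa> (j + 1)\<^sup>2)\<close> of the error.\<close>
lemma prob_exceed_bennett_boundary_le:
  assumes m: "card I \<le> m" "0 < m" and \<alpha>: "0 < \<alpha>" "\<alpha> < 1"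
    and A: "A \<subseteq> {x \<in> space M. \<exists>t. 0 < t \<and> t \<le> 1 \<and>
      real m * t * hinv ((2 * ln (kappa / \<alpha>) + 4 * ln (1 + log 2 (1 / t))) / (real m * t))
        < real (below t x)}"
  shows "prob A \<le> \<alpha>"
proof -
  have \<kappa>\<alpha>: "1 < kappa / \<alpha>" using kappa_gt_1 \<alpha> by simp
  define C where "C = (\<lambda>j::nat. 2 * ln (kappa / \<alpha>) + 4 * ln (1 + real j))"
  \<comment> \<open>Slab \<open>j\<close> has lower end \<open>a j\<close> and upper end
    \<open>2 * a j\<close>. The tilt satisfies \<open>1 + c j / a j = z j\<close>, and
    \<open>B j\<close> is the process at \<open>a j\<close> for the count m a_j z_j.\<close>
  define a where "a = (\<lambda>j::nat. (1 / 2 :: real) ^ Suc j)"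
  define z where "z = (\<lambda>j. hinv (C j / (real m * (2 * a j))))"
  define c where "c = (\<lambda>j. a j * (z j - 1))"
  define B where "B = (\<lambda>j. exp (real m * (a j * z j * ln (z j))))"
  define d where "d = (\<lambda>j::nat. \<alpha> / kappa * (1 / (real j + 1)\<^sup>2))"
  define E where "E = (\<lambda>j. {x \<in> space M. \<exists>t. 0 < t \<and> t \<le> 1 \<and> B j \<le> (1 + c j / t) ^ below t x})"
  have a: "0 < a j" for j by (simp add: a_def)
  have C: "0 < C j" for j
    using \<kappa>\<alpha> by (auto simp: C_def intro!: add_pos_nonneg)
  have Cm: "0 < C j / (real m * (2 * a j))" for j using C a m by simp
  have z: "1 < z j" "hfun (z j) = C j / (real m * (2 * a j))" for j
    unfolding z_def using hinv_gt_1[OF Cm] hfun_hinv[OF Cm] by auto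
  have c: "0 < c j" for j using a z by (simp add: c_def)
  have d: "0 < d j" "d j < 1" for j
  proof -
    have k: "0 < \<alpha> / kappa" "\<alpha> / kappa < 1" using kappa_gt_1 \<alpha> by auto
    have "1 / (real j + 1)\<^sup>2 \<le> 1" by simp
    then have "d j \<le> \<alpha> / kappa * 1"
      unfolding d_def using k by (intro mult_left_mono) auto
    then show "d j < 1" using k by simp
    show "0 < d j" unfolding d_def using k(1) by (intro mult_pos_pos) auto
  qed
  have sd: "d sums \<alpha>"
    using sums_mult[OF inverse_squares_sums_kappa, of "\<alpha> / kappa"] kappa_gt_1 by (simp add: d_def)
  \<comment> \<open>The share \<open>d j\<close> equals exp (- C_j / 2), which accounts for the
    coefficients 2 and 4 in \<open>C\<close>.\<close>
  have ln_d: "ln (d j) = - (C j / 2)" for j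
    using \<alpha> kappa_gt_1 by (simp add: d_def C_def ln_div ln_mult ln_realpow add.commute) (simp add: field_simps)
  have cond: "(1 + c j) ^ card I \<le> d j * B j" for j
  proof -
    have "(1 + c j) ^ card I \<le> (1 + c j) ^ m"
      using m c[of j] by (intro power_increasing) auto
    also have "\<dots> \<le> exp (c j) ^ m"
      using c[of j] by (intro power_mono exp_ge_add_one_self) auto
    also have "\<dots> = exp (real m * c j)" by (simp add: exp_of_nat_mult)
    also have "\<dots> = exp (ln (d j) + real m * (a j * z j * ln (z j)))"
    proof -
      \<comment> \<open>The half is the ratio of the slab's ends: \<open>z j\<close> is defined at
        the upper end but used at the lower.\<close>
      have "real m * a j * hfun (z j) = C j / 2"
        unfolding z(2) using m a[of j] by simp
      then show ?thesis unfolding ln_d by (simp add: c_def hfun_def algebra_simps)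
    qed
    also have "\<dots> = d j * B j" using d[of j] by (simp add: exp_add B_def)
    finally show ?thesis .
  qed
  have E_sets: "E j \<in> sets M" and E_prob: "prob (E j) \<le> d j" for j
    unfolding E_def using crossing_event_sets'[OF c d cond] maximal_inequality_ratio[OF c d cond] by auto
  have "A \<subseteq> (\<Union>j. E j)"
  proof
    fix x assume "x \<in> A"
    with A obtain t where x: "x \<in> space M" and t: "0 < t" "t \<le> 1"
      and lt: "real m * t * hinv ((2 * ln (kappa / \<alpha>) + 4 * ln (1 + log 2 (1 / t))) / (real m * t))
        < real (below t x)" by auto
    define l where "l = log 2 (1 / t)"
    have l0: "0 \<le> l" using t by (simp add: l_def)
    define j where "j = nat \<lfloor>l\<rfloor>"
    have j: "real j \<le> l" "l < real j + 1"
      using l0 by (auto simp: j_def)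
    have tl: "t = 2 powr (- l)"
      using t by (simp add: l_def powr_minus divide_simps)
    have half_power: "(1 / 2 :: real) ^ n = 2 powr (- real n)" for n
      by (simp add: powr_minus powr_realpow power_one_over inverse_eq_divide)
    have aj: "2 * a j = 2 powr (- real j)" "a j = 2 powr (- (real j + 1))"
      using half_power[of j] half_power[of "Suc j"] by (auto simp: a_def add.commute)
    have ta: "t \<le> 2 * a j" "a j \<le> t"
      unfolding tl aj(1) using j aj(2) by auto
    \<comment> \<open>On the slab the argument of \<open>hinv\<close> is smallest at the upper end,
      where it defines \<open>z j\<close>.\<close>
    have "C j / (real m * (2 * a j)) \<le> (2 * ln (kappa / \<alpha>) + 4 * ln (1 + l)) / (real m * t)"
    proof (rule frac_le)
      show "C j \<le> 2 * ln (kappa / \<alpha>) + 4 * ln (1 + l)" using j by (simp add: C_def)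
      then show "0 \<le> 2 * ln (kappa / \<alpha>) + 4 * ln (1 + l)" using C[of j] by linarith
      show "0 < real m * t" "real m * t \<le> real m * (2 * a j)" using m t ta by auto
    qed
    then have "z j \<le> hinv ((2 * ln (kappa / \<alpha>) + 4 * ln (1 + l)) / (real m * t))"
      unfolding z_def using Cm by (intro hinv_mono)
    then have "real m * t * z j \<le> real (below t x)"
      using lt t m mult_left_mono[of "z j" _ "real m * t"] unfolding l_def[symmetric]
      by (meson less_imp_le mult_nonneg_nonneg of_nat_0_le_iff order_trans)
    then have "exp (real m * t * z j * ln (1 + c j / t)) \<le> (1 + c j / t) ^ below t x"
      using t c by (intro exp_le_power_below)
    moreover have "B j \<le> exp (real m * t * z j * ln (1 + c j / t))"
    proof -
      have "1 + c j / a j = z j" using a[of j] by (simp add: c_def)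
      then have "a j * ln (z j) \<le> t * ln (1 + c j / t)"
        using mult_ln_one_plus_divide_mono[OF a ta(2), of "c j"] c[of j] by simp
      then have "real m * z j * (a j * ln (z j)) \<le> real m * z j * (t * ln (1 + c j / t))"
        using z(1)[of j] by (intro mult_left_mono) auto
      then show ?thesis by (simp add: B_def mult_ac)
    qed
    ultimately have "x \<in> E j" unfolding E_def using x t by force
    then show "x \<in> (\<Union>j. E j)" by blast
  qed
  then have "prob A \<le> prob (\<Union>j. E j)"
    using E_sets by (intro finite_measure_mono) auto
  also have "prob (\<Union>j. E j) \<le> (\<Sum>j. d j)"
  proof -
    have sE: "summable (\<lambda>j. prob (E j))"
      using E_prob by (intro summable_comparison_test'[OF sums_summable[OF sd]]) auto
    then have "prob (\<Union>j. E j) \<le> (\<Sum>j. prob (E j))"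
      using E_sets by (intro finite_measure_subadditive_countably) auto
    also have "\<dots> \<le> (\<Sum>j. d j)"
      using E_prob sE sums_summable[OF sd] by (intro suminf_le)
    finally show ?thesis .
  qed
  also have "(\<Sum>j. d j) = \<alpha>" using sd by (simp add: sums_iff)
  finally show ?thesis .
qed

end

section \<open>Joint error rates of the three reference families\<close>

theorem mainTheorem3:
  fixes M :: "'a measure" and m :: nat and p :: "nat \<Rightarrow> 'a \<Rightarrow> real"
    and H0 :: "nat set" and \<sigma> :: "'a \<Rightarrow> nat \<Rightarrow> nat" and \<alpha> :: real
  assumes "prob_space M"
    and H0_sub: "H0 \<subseteq> {1..m}"
    and p_meas: "\<And>i. i \<in> {1..m} \<Longrightarrow> p i \<in> borel_measurable M"
    and p_range: "\<And>i x. i \<in> {1..m} \<Longrightarrow> x \<in> space M \<Longrightarrow> 0 \<le> p i x \<and> p i x \<le> 1"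
    and A1: "\<And>i t. i \<in> H0 \<Longrightarrow>
               measure M {x \<in> space M. p i x \<le> t} \<le> max 0 (min t 1)"
    and A2: "prob_space.indep_vars M (\<lambda>_. borel) p H0"
    and alpha: "0 < \<alpha>" "\<alpha> < 1"
    and \<sigma>_perm: "\<And>x. x \<in> space M \<Longrightarrow> bij_betw (\<sigma> x) {1..m} {1..m}"
    and \<sigma>_sort: "\<And>x j k. x \<in> space M \<Longrightarrow> 1 \<le> j \<Longrightarrow> j \<le> k \<Longrightarrow> k \<le> m \<Longrightarrow>
                   p (\<sigma> x j) x \<le> p (\<sigma> x k) x"
    and \<sigma>_meas: "\<And>j. (\<lambda>x. \<sigma> x j) \<in> measurable M (count_space UNIV)"
  shows
    "JER M m H0 (\<lambda>x k. \<sigma> x ` {1..k}) (\<lambda>x k. zeta_hoeffding m \<alpha> k (p (\<sigma> x k) x)) \<le> \<alpha> \<and>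
     JER M m H0 (\<lambda>x k. \<sigma> x ` {1..k}) (\<lambda>x k. zeta_bennett m \<alpha> k (p (\<sigma> x k) x)) \<le> \<alpha> \<and>
     JER M m H0 (\<lambda>x k. \<sigma> x ` {1..k}) (\<lambda>x k. zeta_simes m \<alpha> k (p (\<sigma> x k) x)) \<le> \<alpha>"
proof -
  have fin: "finite H0" using H0_sub finite_subset by blast
  interpret prob_space M by fact
  interpret superuniform_pvalues M H0 p
  proof
    show "prob {x \<in> space M. p i x \<le> t} \<le> t" if "i \<in> H0" "0 \<le> t" "t \<le> 1" for i t
      using A1[of i t] that by simp
  qed (use fin A2 in auto)
  have card_m: "card H0 \<le> m" using card_mono[OF _ H0_sub] by simp
  \<comment> \<open>Common reduction; \<open>Q t n\<close> says that the count \<open>n\<close>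
    violates the boundary at \<open>t\<close>. \<open>exceed\<close> may assume
    \<open>n \<le> k\<close> because the k-th rejection set has at most \<open>k\<close> elements,
    which makes the cap at \<open>k\<close> harmless. \<open>bound\<close> covers arbitrary subsets,
    measurable or not.\<close>
  have JER_le: "JER M m H0 (\<lambda>x k. \<sigma> x ` {1..k}) (\<lambda>x k. \<zeta> k (p (\<sigma> x k) x)) \<le> \<alpha>"
    if zero: "\<And>k. \<zeta> k 0 = 0"
      and exceed: "\<And>k t n. 1 \<le> k \<Longrightarrow> k \<le> m \<Longrightarrow> 0 < t \<Longrightarrow> t \<le> 1 \<Longrightarrow> n \<le> k \<Longrightarrow> \<zeta> k t < int n \<Longrightarrow> Q t n"
      and mono: "\<And>t n n'. Q t n \<Longrightarrow> n \<le> n' \<Longrightarrow> Q t n'"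
      and bound: "\<And>A. A \<subseteq> {x \<in> space M. \<exists>t. 0 < t \<and> t \<le> 1 \<and> Q t (below t x)} \<Longrightarrow> prob A \<le> \<alpha>"
    for \<zeta> :: "nat \<Rightarrow> real \<Rightarrow> int" and Q :: "real \<Rightarrow> nat \<Rightarrow> bool"
  proof -
    let ?S = "{x \<in> space M. \<exists>k\<in>{1..m}. int (card (\<sigma> x ` {1..k} \<inter> H0)) > \<zeta> k (p (\<sigma> x k) x)}"
    let ?Z = "{x \<in> space M. \<exists>i\<in>H0. p i x \<le> 0}"
    have Z: "?Z \<in> sets M" using fin by measurable
    have sub: "?S - ?Z \<subseteq> {x \<in> space M. \<exists>t. 0 < t \<and> t \<le> 1 \<and> Q t (below t x)}"
    proof
      fix x assume "x \<in> ?S - ?Z"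
      then obtain k where x: "x \<in> space M" and k: "1 \<le> k" "k \<le> m"
        and gt: "\<zeta> k (p (\<sigma> x k) x) < int (card (\<sigma> x ` {1..k} \<inter> H0))" and nz: "\<And>i. i \<in> H0 \<Longrightarrow> 0 < p i x"
        by force
      define t where "t = p (\<sigma> x k) x"
      have "\<sigma> x k \<in> {1..m}" using bij_betwE[OF \<sigma>_perm[OF x]] k by auto
      then have t: "0 \<le> t" "t \<le> 1" using p_range x by (auto simp: t_def)
      have le_t: "p i x \<le> t" if "i \<in> \<sigma> x ` {1..k}" for i
        using that \<sigma>_sort[OF x _ _ k(2)] by (auto simp: t_def)
      \<comment> \<open>If the k-th smallest p-value is zero, so is \<zeta>, and an error puts a
        null with p-value zero into the rejection set; this is excluded off
        \<open>?Z\<close>.\<close>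
      have "0 < t"
      proof (rule ccontr)
        assume "\<not> 0 < t"
        with t have t0: "t = 0" by simp
        with gt zero have "0 < card (\<sigma> x ` {1..k} \<inter> H0)" by (simp add: t_def)
        then have "\<sigma> x ` {1..k} \<inter> H0 \<noteq> {}" by (metis card.empty less_irrefl)
        then obtain i where "i \<in> \<sigma> x ` {1..k}" "i \<in> H0" by blast
        then show False using le_t nz t0 by force
      qed
      have "card (\<sigma> x ` {1..k} \<inter> H0) \<le> card (\<sigma> x ` {1..k})" by (intro card_mono) auto
      also have "\<dots> \<le> k" using card_image_le[of "{1..k}" "\<sigma> x"] by simp
      finally have "Q t (card (\<sigma> x ` {1..k} \<inter> H0))"
        using exceed k \<open>0 < t\<close> t gt by (simp add: t_def)
      moreover have "card (\<sigma> x ` {1..k} \<inter> H0) \<le> below t x"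
        unfolding below_def using fin le_t by (intro card_mono) auto
      ultimately have "Q t (below t x)" by (rule mono)
      then show "x \<in> {x \<in> space M. \<exists>t. 0 < t \<and> t \<le> 1 \<and> Q t (below t x)}"
        using x \<open>0 < t\<close> t by auto
    qed
    have "prob ?S \<le> \<alpha>"
    \<comment> \<open>\<open>measure\<close> has default value 0 outside
      \<open>sets M\<close>.\<close>
    proof (cases "?S \<in> sets M")
      case True
      then have "prob ?S \<le> prob ((?S - ?Z) \<union> ?Z)"
        using Z by (intro finite_measure_mono) auto
      also have "\<dots> \<le> prob (?S - ?Z) + prob ?Z"
        using True Z by (intro measure_Un_le) auto
      also have "\<dots> \<le> \<alpha>"
        using bound[OF sub] prob_some_nonpos_eq_0 by simp
      finally show ?thesis .
    next
      case False
      then show ?thesis using alpha by (simp add: measure_notin_sets)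
    qed
    then show ?thesis by (simp add: JER_def)
  qed
  have "JER M m H0 (\<lambda>x k. \<sigma> x ` {1..k}) (\<lambda>x k. zeta_hoeffding m \<alpha> k (p (\<sigma> x k) x)) \<le> \<alpha>"
  proof (rule JER_le[of "zeta_hoeffding m \<alpha>" "\<lambda>t n. real m * t + sqrt (real m / 2 * ln (1 / \<alpha>)) < real n"])
    fix k n :: nat and t :: real
    assume "0 < t" "n \<le> k" "zeta_hoeffding m \<alpha> k t < int n"
    then have "\<lfloor>real m * t + sqrt (real m / 2 * ln (1 / \<alpha>))\<rfloor> < int n"
      by (simp add: zeta_hoeffding_def min_less_iff_disj)
    then show "real m * t + sqrt (real m / 2 * ln (1 / \<alpha>)) < real n"
      by (simp add: floor_less_iff)
  qed (erule prob_exceed_hoeffding_boundary_le[OF card_m alpha] | force simp: zeta_hoeffding_def)+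
  moreover have "JER M m H0 (\<lambda>x k. \<sigma> x ` {1..k}) (\<lambda>x k. zeta_bennett m \<alpha> k (p (\<sigma> x k) x)) \<le> \<alpha>"
  proof (cases "m = 0")
    case True
    then show ?thesis using alpha by (simp add: JER_def)
  next
    case False
    let ?b = "\<lambda>t. real m * t * hinv ((2 * ln (kappa / \<alpha>) + 4 * ln (1 + log 2 (1 / t))) / (real m * t))"
    show ?thesis
    proof (rule JER_le[of "zeta_bennett m \<alpha>" "\<lambda>t n. ?b t < real n"])
      fix k n :: nat and t :: real
      assume "0 < t" "n \<le> k" "zeta_bennett m \<alpha> k t < int n"
      then have "\<lfloor>?b t\<rfloor> < int n"
        by (simp add: zeta_bennett_def min_less_iff_disj)
      then show "?b t < real n" by (simp add: floor_less_iff)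
    qed (use False in \<open>auto simp: zeta_bennett_def intro: prob_exceed_bennett_boundary_le[OF card_m _ alpha]\<close>)
  qed
  moreover have "JER M m H0 (\<lambda>x k. \<sigma> x ` {1..k}) (\<lambda>x k. zeta_simes m \<alpha> k (p (\<sigma> x k) x)) \<le> \<alpha>"
  proof (cases "m = 0")
    case True
    then show ?thesis using alpha by (simp add: JER_def)
  next
    case False
    show ?thesis
    proof (rule JER_le[of "zeta_simes m \<alpha>" "\<lambda>t n. real m * t / \<alpha> \<le> real n"])
      fix k n :: nat and t :: real
      assume "0 < t" "n \<le> k" "zeta_simes m \<alpha> k t < int n"
      \<comment> \<open>The ceiling minus one is below \<open>n\<close> iff the ceiling is at most
        \<open>n\<close>; hence the weak inequality in this boundary.\<close>
      then have "\<lceil>real m * t / \<alpha>\<rceil> \<le> int n"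
        by (simp add: zeta_simes_def min_less_iff_disj)
      then show "real m * t / \<alpha> \<le> real n" by (simp add: ceiling_le_iff)
    qed (use False in \<open>auto simp: zeta_simes_def intro: prob_exceed_simes_boundary_le[OF card_m _ alpha(1)]\<close>)
  qed
  ultimately show ?thesis by blast
qed

end
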